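(* Let $q=2mn+1$ be a prime power, where $m,n$ are odd and coprime positive integers. Let $\xi\in\mathbb{F}_q^*$ have multiplicative order $n$ and $\epsilon\in\mathbb{F}_q^*$ have multiplicative order $m$, and let $A_{m,n}=(a_{i,j})$ be the totally filled $m\times n$ array with entries in $\mathbb{F}_q$ given by $a_{i,j}=\epsilon^{i-1}\xi^{j-1}$ ($1\le i\le m$, $1\le j\le n$). Let $\omega_r$ and $\omega_c$ be the natural orderings (each row from left to right, each column from top to bottom). Then $\omega_r$ and $\omega_c$ are simple and compatible orderings of $A_{m,n}$, and they induce an Archdeacon embedding $\Pi_{m,n}$ of $K_q$ whose faces are simple cycles of length $m$ and $n$.
   Context: $A_{m,n}$ is a Heffter array $H(m,n)$ over the additive group of $\mathbb{F}_q$: an $m\times n$ array with entries in a group $G$ of order $2mn+1$ (written additively) such that every row and every column sums to $0$ and the multiset $\{\pm x : x \text{ an entry of the array}\}$ contains each element of $G\setminus\{0\}$ exactly once. Let $\mathcal{E}(A)$ denote the set of entries. An ordering of a row (resp. column) is a cyclic order of its entries; the row orderings together define a permutation $\omega_r$ of $\mathcal{E}(A)$ sending each entry to the next entry of its row (cyclically), and similarly the column orderings define $\omega_c$. For the natural orderings, $\omega_r(a_{i,j})=a_{i,j+1}$ and $\omega_c(a_{i,j})=a_{i+1,j}$ with column indices modulo $n$ and row indices modulo $m$. An ordering $(t_1,\dots,t_k)$ of a row or column is simple if its partial sums $s_i=\sum_{j\le i}t_j$, $1\le i\le k$, are pairwise distinct; $\omega_r,\omega_c$ are simple if every row and column ordering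 is simple. The orderings are compatible if $\omega_c\circ\omega_r$ is a single cycle of length $|\mathcal{E}(A)|$. Given compatible orderings, define the permutation $\rho_0$ of $G\setminus\{0\}$ by $\rho_0(a)=-\omega_r(a)$ if $a\in\mathcal{E}(A)$ and $\rho_0(a)=\omega_c(-a)$ if $a\in-\mathcal{E}(A)$, and the map $\rho$ on oriented edges of the complete graph $K_v$ with vertex set $G$ ($v=|G|$) by $\rho((x,x+a))=(x,x+\rho_0(a))$. The pair $\Pi=(K_v,\rho)$ is the Archdeacon embedding (a combinatorial embedding into an orientable surface: $\rho$ cyclically permutes the oriented edges leaving each vertex). Its faces are the boundary walks given by the orbits of the map $(x,y)\mapsto (y,\rho_y(x))$ on oriented edges, where $\rho(y,z)=(y,\rho_y(z))$.
   Formalization: The claims that A is a Heffter array and that the faces are simple cycles of length m and n are stated for m, n > 1 only; they fail if m = 1 or n = 1 (e.g. m = 1, n = 3, q = 7 has faces of length 7). Simplicity, compatibility and the embedding are stated for all m, n. *)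

theory Defs
  imports
    Complex_Main
    "HOL-Library.Multiset"
    "HOL-Library.Cardinality"
    "HOL-Combinatorics.Orbits"
begin

text \<open>
  An \<open>m \<times> n\<close> array is a function of a row index \<open>i \<in> {1..m}\<close> and a column index \<open>j \<in> {1..n}\<close>;
  its values outside this range play no role.
\<close>

definition entries :: "nat \<Rightarrow> nat \<Rightarrow> (nat \<Rightarrow> nat \<Rightarrow> 'a) \<Rightarrow> 'a set" where
  "entries m n A = {A i j | i j. i \<in> {1..m} \<and> j \<in> {1..n}}"

definition heffter_array :: "nat \<Rightarrow> nat \<Rightarrow> (nat \<Rightarrow> nat \<Rightarrow> 'a::{ab_group_add,finite}) \<Rightarrow> bool" where
  "heffter_array m n A \<longleftrightarrow>
     CARD('a) = 2 * m * n + 1 \<and>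
     (\<forall>i\<in>{1..m}. (\<Sum>j\<in>{1..n}. A i j) = 0) \<and>
     (\<forall>j\<in>{1..n}. (\<Sum>i\<in>{1..m}. A i j) = 0) \<and>
     (\<Sum>i\<in>{1..m}. \<Sum>j\<in>{1..n}. {#A i j, - A i j#}) = mset_set (UNIV - {0})"

definition mult_order :: "'a::monoid_mult \<Rightarrow> nat" where
  "mult_order x = (LEAST k. 0 < k \<and> x ^ k = 1)"

text \<open>
  An ordering of all rows (or all columns) is a list of lists, one list \<open>[t\<^sub>1, \<dots>, t\<^sub>k]\<close> for each
  row (column), read cyclically.
\<close>

definition natural_rows :: "nat \<Rightarrow> nat \<Rightarrow> (nat \<Rightarrow> nat \<Rightarrow> 'a) \<Rightarrow> 'a list list" where
  "natural_rows m n A = map (\<lambda>i. map (\<lambda>j. A i j) [1..<Suc n]) [1..<Suc m]"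

definition natural_cols :: "nat \<Rightarrow> nat \<Rightarrow> (nat \<Rightarrow> nat \<Rightarrow> 'a) \<Rightarrow> 'a list list" where
  "natural_cols m n A = map (\<lambda>j. map (\<lambda>i. A i j) [1..<Suc m]) [1..<Suc n]"

definition partial_sums :: "'a::monoid_add list \<Rightarrow> 'a list" where
  "partial_sums ts = map (\<lambda>i. sum_list (take i ts)) [1..<Suc (length ts)]"

definition simple_ordering :: "'a::monoid_add list \<Rightarrow> bool" where
  "simple_ordering ts \<longleftrightarrow> distinct (partial_sums ts)"

text \<open>
  The permutation sending each listed element to its cyclic successor in its list. The description
  is only meaningful when the entries of the array are pairwise distinct.
\<close>

definition ordering_perm :: "'a list list \<Rightarrow> 'a \<Rightarrow> 'a" where
  "ordering_perm ls x =
     (if \<exists>l\<in>set ls. x \<in> set l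
      then THE y. \<exists>l\<in>set ls. \<exists>k<length l. l ! k = x \<and> l ! (Suc k mod length l) = y
      else x)"

lemma ordering_perm_natural_rows:
  assumes inj: "inj_on (\<lambda>(i, j). A i j) ({1..m} \<times> {1..n})"
    and i: "i \<in> {1..m}" and j: "j \<in> {1..n}"
  shows "ordering_perm (natural_rows m n A) (A i j) = A i (if j = n then 1 else j + 1)"
proof -
  have ex: "\<exists>l\<in>set (natural_rows m n A). A i j \<in> set l"
    using i j by (auto simp: natural_rows_def simp del: upt_Suc intro!: bexI[of _ i])
  have "(THE y. \<exists>l\<in>set (natural_rows m n A). \<exists>k<length l. l ! k = A i j \<and> l ! (Suc k mod length l) = y)
    = A i (if j = n then 1 else j + 1)"
  proof (rule the_equality)
    have "map (A i) [1..<Suc n] \<in> set (natural_rows m n A)"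
      using i by (auto simp: natural_rows_def simp del: upt_Suc)
    moreover have "j - 1 < length (map (A i) [1..<Suc n])" using j by auto
    moreover have "map (A i) [1..<Suc n] ! (j - 1) = A i j"
      using j nth_map[of "j - 1" "[1..<Suc n]" "A i"] nth_upt[of 1 "j - 1" "Suc n"]
      by (auto simp del: upt_Suc)
    moreover have "map (A i) [1..<Suc n] ! (Suc (j - 1) mod length (map (A i) [1..<Suc n]))
      = A i (if j = n then 1 else j + 1)"
      using j by (cases "j = n") (auto simp: nth_map nth_upt simp del: upt_Suc)
    ultimately show "\<exists>l\<in>set (natural_rows m n A). \<exists>k<length l. l ! k = A i j \<and>
        l ! (Suc k mod length l) = A i (if j = n then 1 else j + 1)" by blast
  next
    fix y
    assume "\<exists>l\<in>set (natural_rows m n A). \<exists>k<length l. l ! k = A i j \<and> l ! (Suc k mod length l) = y"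
    then obtain i' k where i': "i' \<in> {1..m}" and k: "k < n"
      and eq: "A i' (Suc k) = A i j"
      and y: "map (A i') [1..<Suc n] ! (Suc k mod n) = y"
      by (auto simp: natural_rows_def less_Suc_eq_le simp del: upt_Suc)
    have "(i', Suc k) = (i, j)"
      using inj_onD[OF inj, of "(i', Suc k)" "(i, j)"] eq i' k i j by auto
    then show "y = A i (if j = n then 1 else j + 1)"
      using y j by (cases "j = n") (auto simp del: upt_Suc)
  qed
  then show ?thesis using ex by (simp add: ordering_perm_def)
qed

definition compatible :: "'a set \<Rightarrow> ('a \<Rightarrow> 'a) \<Rightarrow> ('a \<Rightarrow> 'a) \<Rightarrow> bool" where
  "compatible E \<omega>r \<omega>c \<longleftrightarrow> cyclic_on (\<omega>c \<circ> \<omega>r) E"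

definition archdeacon_rot0 ::
  "'a set \<Rightarrow> ('a \<Rightarrow> 'a) \<Rightarrow> ('a \<Rightarrow> 'a) \<Rightarrow> 'a \<Rightarrow> 'a::ab_group_add" where
  "archdeacon_rot0 E \<omega>r \<omega>c a =
     (if a \<in> E then - \<omega>r a else if a \<in> uminus ` E then \<omega>c (- a) else a)"

definition archdeacon_rot ::
  "'a set \<Rightarrow> ('a \<Rightarrow> 'a) \<Rightarrow> ('a \<Rightarrow> 'a) \<Rightarrow> 'a \<times> 'a \<Rightarrow> 'a \<times> 'a::ab_group_add" where
  "archdeacon_rot E \<omega>r \<omega>c = (\<lambda>(x, y). (x, x + archdeacon_rot0 E \<omega>r \<omega>c (y - x)))"

definition complete_arcs :: "('a \<times> 'a) set" where
  "complete_arcs = {(x, y). x \<noteq> y}"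

text \<open>In the following, \<open>D\<close> is the set of oriented edges of a graph with vertex set \<open>V\<close>.\<close>

definition combinatorial_embedding ::
  "'a set \<Rightarrow> ('a \<times> 'a) set \<Rightarrow> ('a \<times> 'a \<Rightarrow> 'a \<times> 'a) \<Rightarrow> bool" where
  "combinatorial_embedding V D \<rho> \<longleftrightarrow> (\<forall>x\<in>V. cyclic_on \<rho> {d \<in> D. fst d = x})"

definition face_step :: "('a \<times> 'a \<Rightarrow> 'a \<times> 'a) \<Rightarrow> 'a \<times> 'a \<Rightarrow> 'a \<times> 'a" where
  "face_step \<rho> = (\<lambda>(x, y). (y, snd (\<rho> (y, x))))"

text \<open>
  The boundary walk through an oriented edge \<open>e\<close>, as the cyclic list of the initial vertices of the
  oriented edges met while running once through the orbit of \<open>e\<close>. In \<open>faces\<close> every face is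
  represented by all its rotations.
\<close>

definition boundary_walk :: "('a \<times> 'a \<Rightarrow> 'a \<times> 'a) \<Rightarrow> 'a \<times> 'a \<Rightarrow> 'a list" where
  "boundary_walk \<rho> e =
     map (\<lambda>k. fst ((face_step \<rho> ^^ k) e)) [0..<card (orbit (face_step \<rho>) e)]"

definition faces :: "('a \<times> 'a) set \<Rightarrow> ('a \<times> 'a \<Rightarrow> 'a \<times> 'a) \<Rightarrow> 'a list set" where
  "faces D \<rho> = boundary_walk \<rho> ` D"

definition simple_cycle :: "('a \<times> 'a) set \<Rightarrow> 'a list \<Rightarrow> bool" where
  "simple_cycle D ws \<longleftrightarrow>
     3 \<le> length ws \<and> distinct ws \<and>
     (\<forall>k<length ws. (ws ! k, ws ! (Suc k mod length ws)) \<in> D)"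

end

theory Submission
  imports Defs "HOL-Number_Theory.Residues"
begin

text \<open>
  Since \<open>m\<close> and \<open>n\<close> are coprime, the entries form the subgroup \<open>E\<close> of order \<open>mn\<close> of the
  multiplicative group, generated by \<open>\<epsilon>\<xi>\<close>, and on \<open>E\<close> the natural orderings are multiplication by
  \<open>\<xi>\<close> and by \<open>\<epsilon>\<close>. As \<open>mn\<close> is odd, \<open>-1 \<notin> E\<close>, so \<open>E\<close> and \<open>-E\<close> partition the nonzero
  elements. Hence \<open>\<omega>\<^sub>c \<circ> \<omega>\<^sub>r\<close> is multiplication by a generator of \<open>E\<close>, and \<open>\<rho>\<^sub>0\<close>, which swaps
  \<open>E\<close> and \<open>-E\<close> and whose square is multiplication by \<open>\<epsilon>\<xi>\<close>, is a single cycle. Along a face the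
  differences of consecutive vertices are \<open>d, cd, c\<^sup>2d, \<dots>\<close> with \<open>c = \<epsilon>\<close> if \<open>d \<in> E\<close> and
  \<open>c = \<xi>\<close> otherwise, so the vertices are partial sums of a geometric progression whose ratio has
  order \<open>m\<close> or \<open>n\<close>.
\<close>

section \<open>Multiplicative order and geometric sums\<close>

text \<open>As \<open>mult_order\<close> is a \<open>LEAST\<close>, some positive exponent has to be
  exhibited: finiteness of the field makes two powers coincide, and cancelling gives one.\<close>

lemma mult_order_pos_power:
  fixes x :: "'a::{field,finite}"
  assumes "x \<noteq> 0"
  shows "0 < mult_order x" "x ^ mult_order x = 1"
proof -
  have "\<not> inj (\<lambda>k::nat. x ^ k)"
    using finite_imageD[of "\<lambda>k::nat. x ^ k" UNIV] by auto
  then obtain i j where "i < j" "x ^ i = x ^ j"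
    unfolding inj_def by (metis linorder_neqE_nat)
  then have "x ^ (j - i) = 1"
    using assms by (simp add: power_diff)
  with \<open>i < j\<close> have "\<exists>k. 0 < k \<and> x ^ k = 1"
    by (intro exI[of _ "j - i"]) auto
  from LeastI_ex[OF this] show "0 < mult_order x" "x ^ mult_order x = 1"
    unfolding mult_order_def by auto
qed

lemma mult_order_le:
  assumes "0 < k" "x ^ k = 1"
  shows "mult_order x \<le> k"
  unfolding mult_order_def using assms by (intro Least_le) auto

lemma power_mod_mult_order:
  fixes x :: "'a::{field,finite}"
  assumes "x \<noteq> 0"
  shows "x ^ (k mod mult_order x) = x ^ k"
proof -
  have "x ^ k = x ^ (mult_order x * (k div mult_order x) + k mod mult_order x)"
    by simp
  then show ?thesis
    using mult_order_pos_power(2)[OF assms]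
    unfolding power_add power_mult by simp
qed

lemma mult_order_dvd:
  fixes x :: "'a::{field,finite}"
  assumes "x \<noteq> 0" "x ^ k = 1"
  shows "mult_order x dvd k"
proof (rule ccontr)
  assume "\<not> mult_order x dvd k"
  then have "0 < k mod mult_order x"
    by (simp add: dvd_eq_mod_eq_0)
  moreover have "x ^ (k mod mult_order x) = 1"
    using assms power_mod_mult_order by metis
  ultimately have "mult_order x \<le> k mod mult_order x"
    by (rule mult_order_le)
  then show False
    using mult_order_pos_power(1)[OF assms(1)] by (meson leD mod_less_divisor)
qed

lemma power_neq_power:
  fixes x :: "'a::{field,finite}"
  assumes "x \<noteq> 0" "i < j" "j - i < mult_order x"
  shows "x ^ i \<noteq> x ^ j"
proof
  assume "x ^ i = x ^ j"
  then have "x ^ (j - i) = 1"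
    using assms by (simp add: power_diff)
  then show False
    using mult_order_le[of "j - i" x] assms by auto
qed

text \<open>If the product has order \<open>k\<close>, raising its \<open>k\<close>-th power to the
  order of one factor removes that factor. The order of the other then divides \<open>k\<close>
  times the removed order, and coprimality cancels the latter.\<close>

lemma mult_order_mult_coprime:
  fixes x y :: "'a::{field,finite}"
  assumes x: "x \<noteq> 0" and y: "y \<noteq> 0" and coprime: "coprime (mult_order x) (mult_order y)"
  shows "mult_order (x * y) = mult_order x * mult_order y"
proof (rule antisym)
  have "(x * y) ^ (mult_order x * mult_order y)
      = (x ^ mult_order x) ^ mult_order y * (y ^ mult_order y) ^ mult_order x"
    by (simp add: power_mult_distrib mult.commute flip: power_mult)
  then show "mult_order (x * y) \<le> mult_order x * mult_order y"
    using mult_order_pos_power[OF x] mult_order_pos_power[OF y] by (intro mult_order_le) auto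
next
  define k where "k = mult_order (x * y)"
  have k: "0 < k" "x ^ k * y ^ k = 1"
    using mult_order_pos_power[of "x * y"] x y by (auto simp: k_def power_mult_distrib)
  have "x ^ (k * mult_order y) * (y ^ mult_order y) ^ k = (x ^ k * y ^ k) ^ mult_order y"
    by (simp add: power_mult_distrib mult.commute flip: power_mult)
  then have "mult_order x dvd k * mult_order y"
    using k mult_order_pos_power[OF y] by (intro mult_order_dvd[OF x]) simp
  moreover have "(x ^ mult_order x) ^ k * y ^ (k * mult_order x) = (x ^ k * y ^ k) ^ mult_order x"
    by (simp add: power_mult_distrib mult.commute flip: power_mult)
  then have "mult_order y dvd k * mult_order x"
    using k mult_order_pos_power[OF x] by (intro mult_order_dvd[OF y]) simp
  ultimately have "mult_order x dvd k" "mult_order y dvd k"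
    using coprime by (simp_all add: coprime_dvd_mult_left_iff coprime_commute)
  then have "mult_order x * mult_order y dvd k"
    using coprime by (simp add: divides_mult)
  then show "mult_order x * mult_order y \<le> mult_order (x * y)"
    using k by (simp add: k_def dvd_imp_le)
qed

text \<open>Multiplied by \<open>x - 1\<close>, the sums telescope to \<open>x ^ i - 1\<close> and
  \<open>x ^ j - 1\<close>, so equal sums would force equal powers.\<close>

lemma geometric_sum_neq:
  fixes x :: "'a::{field,finite}"
  assumes "x \<noteq> 0" "i < j" "j - i < mult_order x"
  shows "(\<Sum>k<i. x ^ k) \<noteq> (\<Sum>k<j. x ^ k)"
  using power_neq_power[OF assms] power_diff_1_eq[of x i] power_diff_1_eq[of x j]
  by (metis diff_add_cancel)

lemma geometric_sum_mult_order:
  fixes x :: "'a::{field,finite}"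
  assumes "1 < mult_order x" "x \<noteq> 0"
  shows "(\<Sum>k<mult_order x. x ^ k) = 0"
proof -
  have "x \<noteq> 1"
    using mult_order_le[of 1 x] assms by auto
  then show ?thesis
    using power_diff_1_eq[of x "mult_order x"] mult_order_pos_power[OF assms(2)] by simp
qed

lemma simple_ordering_geometric:
  fixes x c :: "'a::{field,finite}"
  assumes c: "c \<noteq> 0" and x: "x \<noteq> 0"
    and len: "length ts = mult_order x" and nth: "\<And>k. k < length ts \<Longrightarrow> ts ! k = c * x ^ k"
  shows "simple_ordering ts"
proof -
  have "sum_list (take i ts) = c * (\<Sum>k<i. x ^ k)" if "i \<le> length ts" for i
    using that nth
    by (simp add: sum_list_sum_nth sum_distrib_left atLeast0LessThan min_def)
  moreover have "inj_on (\<lambda>i. c * (\<Sum>k<i. x ^ k)) {1..length ts}"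
    using c geometric_sum_neq[OF x] len by (intro linorder_inj_onI) auto
  ultimately have "inj_on (\<lambda>i. sum_list (take i ts)) {1..length ts}"
    by (subst inj_on_cong) auto
  then show ?thesis
    by (simp add: simple_ordering_def partial_sums_def distinct_map
        atLeastLessThanSuc_atLeastAtMost del: upt_Suc)
qed

section \<open>Boundary walks and rotations\<close>

text \<open>Distinct initial vertices make the first \<open>p\<close> arcs distinct, so the period
  \<open>p\<close> is the size of the orbit, which is the length of the walk.\<close>

lemma boundary_walk_eq:
  assumes p: "0 < p" and period: "(face_step \<rho> ^^ p) e = e"
    and distinct: "inj_on (\<lambda>k. fst ((face_step \<rho> ^^ k) e)) {..<p}"
  shows "boundary_walk \<rho> e = map (\<lambda>k. fst ((face_step \<rho> ^^ k) e)) [0..<p]"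
proof -
  have "orbit (face_step \<rho>) e = (\<lambda>k. (face_step \<rho> ^^ k) e) ` {..<p}"
    using orbit_altdef_bounded[OF period p] by auto
  moreover have "inj_on (\<lambda>k. (face_step \<rho> ^^ k) e) {..<p}"
    using distinct by (auto simp: inj_on_def)
  ultimately have "card (orbit (face_step \<rho>) e) = p"
    by (simp add: card_image)
  then show ?thesis
    by (simp add: boundary_walk_def)
qed

lemma simple_cycle_complete_arcs:
  assumes "3 \<le> length ws" "distinct ws"
  shows "simple_cycle complete_arcs ws"
proof -
  have "ws ! k \<noteq> ws ! (Suc k mod length ws)" if "k < length ws" for k
  proof -
    have "Suc k mod length ws < length ws" "Suc k mod length ws \<noteq> k"
      using assms(1) that by (auto simp: mod_Suc)
    then show ?thesis
      using assms(2) that by (simp add: nth_eq_iff_index_eq)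
  qed
  then show ?thesis
    using assms by (simp add: simple_cycle_def complete_arcs_def)
qed

text \<open>The map \<open>b \<mapsto> (x, x + b)\<close> carries \<open>archdeacon_rot0\<close> to
  the rotation at \<open>x\<close>, so one cycle on the nonzero elements gives one cycle at every
  vertex.\<close>

lemma combinatorial_embedding_archdeacon_rot:
  fixes E :: "'a::ab_group_add set"
  assumes "cyclic_on (archdeacon_rot0 E \<omega>r \<omega>c) (UNIV - {0})"
  shows "combinatorial_embedding UNIV complete_arcs (archdeacon_rot E \<omega>r \<omega>c)"
  unfolding combinatorial_embedding_def
proof
  fix x :: 'a
  let ?f = "archdeacon_rot0 E \<omega>r \<omega>c" and ?\<rho> = "archdeacon_rot E \<omega>r \<omega>c"
  obtain a where a: "a \<noteq> 0" "UNIV - {0} = orbit ?f a"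
    using assms by (auto simp: cyclic_on_def)
  have iter: "(?\<rho> ^^ k) (x, x + a) = (x, x + (?f ^^ k) a)" for k
    by (induction k) (auto simp: archdeacon_rot_def)
  have "orbit ?\<rho> (x, x + a) = (\<lambda>b. (x, x + b)) ` orbit ?f a"
    by (auto simp: orbit_altdef iter)
  also have "\<dots> = {d \<in> complete_arcs. fst d = x}"
    by (auto simp flip: a(2) simp: complete_arcs_def image_iff intro!: bexI[of _ "b - x" for b])
  finally show "cyclic_on ?\<rho> {d \<in> complete_arcs. fst d = x}"
    unfolding cyclic_on_def using a(1)
    by (intro bexI[of _ "(x, x + a)"]) (auto simp: complete_arcs_def)
qed

lemma entries_swap: "entries n m (\<lambda>i j. A j i) = entries m n A"
  by (auto simp: entries_def)

lemma natural_cols_swap: "natural_cols m n A = natural_rows n m (\<lambda>i j. A j i)"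
  by (simp add: natural_cols_def natural_rows_def)

section \<open>The array of products of powers\<close>

locale power_array =
  fixes m n :: nat
    and \<xi> \<epsilon> :: "'a::{field,finite}"
    and A :: "nat \<Rightarrow> nat \<Rightarrow> 'a"
  assumes card_field: "CARD('a) = 2 * m * n + 1"
    and odd: "odd m" "odd n" and coprime: "coprime m n"
    and xi: "\<xi> \<noteq> 0" "mult_order \<xi> = n"
    and eps: "\<epsilon> \<noteq> 0" "mult_order \<epsilon> = m"
    and array: "\<And>i j. i \<in> {1..m} \<Longrightarrow> j \<in> {1..n} \<Longrightarrow> A i j = \<epsilon> ^ (i - 1) * \<xi> ^ (j - 1)"
begin

text \<open>Exchanging rows with columns and \<xi> with \<epsilon> preserves the assumptions, so
  facts about columns follow from those about rows.\<close>

lemma transpose: "power_array n m \<epsilon> \<xi> (\<lambda>i j. A j i)"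
  using card_field odd coprime xi eps array
  by unfold_locales (auto simp: mult.commute coprime_commute)

lemma pos: "0 < m" "0 < n"
  using odd by (auto intro: odd_pos)

lemma xi_power: "\<xi> ^ n = 1" and eps_power: "\<epsilon> ^ m = 1"
  using mult_order_pos_power xi eps by auto

lemma mult_order_generator: "mult_order (\<epsilon> * \<xi>) = m * n"
  using mult_order_mult_coprime[OF eps(1) xi(1)] xi eps coprime by simp

section \<open>The entries as a cyclic multiplicative group\<close>

lemma entries_image: "entries m n A = (\<lambda>(i, j). A i j) ` ({1..m} \<times> {1..n})"
  unfolding entries_def by force

lemma generator_power: "(\<epsilon> * \<xi>) ^ (m * n) = 1"
  using mult_order_pos_power[of "\<epsilon> * \<xi>"] mult_order_generator xi eps by simp

text \<open>Every power of the generator is an entry. There are \<open>m * n\<close> distinct powers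
  and at most that many entries, so counting turns the inclusion into equality.\<close>

lemma
  shows entries_eq_powers: "entries m n A = range (\<lambda>k. (\<epsilon> * \<xi>) ^ k)"
    and card_entries: "card (entries m n A) = m * n"
proof -
  let ?P = "range (\<lambda>k. (\<epsilon> * \<xi>) ^ k)"
  have sub: "?P \<subseteq> entries m n A"
  proof clarify
    fix k
    have "(\<epsilon> * \<xi>) ^ k = A (Suc (k mod m)) (Suc (k mod n))"
      using pos power_mod_mult_order[OF eps(1), of k] power_mod_mult_order[OF xi(1), of k]
      by (subst array) (auto simp: xi eps power_mult_distrib Suc_leI)
    moreover have "Suc (k mod m) \<in> {1..m}" "Suc (k mod n) \<in> {1..n}"
      using pos by (auto simp: Suc_leI)
    ultimately show "(\<epsilon> * \<xi>) ^ k \<in> entries m n A"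
      unfolding entries_def by blast
  qed
  have "inj_on (\<lambda>k. (\<epsilon> * \<xi>) ^ k) {..<m * n}"
    using power_neq_power[of "\<epsilon> * \<xi>"] xi eps mult_order_generator
    by (intro linorder_inj_onI) auto
  then have "card ((\<lambda>k. (\<epsilon> * \<xi>) ^ k) ` {..<m * n}) = m * n"
    by (simp add: card_image)
  then have lower: "m * n \<le> card ?P"
    using card_mono[of ?P "(\<lambda>k. (\<epsilon> * \<xi>) ^ k) ` {..<m * n}"] by fastforce
  have upper: "card (entries m n A) \<le> m * n"
    using card_image_le[of "{1..m} \<times> {1..n}" "\<lambda>(i, j). A i j"] by (simp add: entries_image)
  show eq: "entries m n A = ?P"
    using card_seteq[OF _ sub] lower upper by simp
  show "card (entries m n A) = m * n"
    using lower upper eq by simp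
qed

text \<open>There are as many values as cells. This injectivity is what gives
  \<open>ordering_perm\<close> its meaning.\<close>

lemma inj_array: "inj_on (\<lambda>(i, j). A i j) ({1..m} \<times> {1..n})"
  using card_entries by (intro eq_card_imp_inj_on) (auto simp: entries_image)

lemma entries_mult: "x \<in> entries m n A \<Longrightarrow> y \<in> entries m n A \<Longrightarrow> x * y \<in> entries m n A"
  by (auto simp: entries_eq_powers simp flip: power_add)

lemma one_in_entries: "1 \<in> entries m n A"
  by (auto simp: entries_eq_powers intro: range_eqI[of _ _ 0])

lemma xi_in_entries: "\<xi> \<in> entries m n A"
proof -
  \<comment> \<open>The column index is 2 in general; the residue also covers \<open>n = 1\<close>,
    where \<xi> is 1 and column 1 is the only one.\<close>
  have range: "1 \<in> {1..m}" "Suc (1 mod n) \<in> {1..n}"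
    using pos by (auto simp: Suc_leI)
  then have "\<xi> = A 1 (Suc (1 mod n))"
    using power_mod_mult_order[OF xi(1), of 1] by (simp only: array[OF range]) (simp add: xi(2))
  with range show ?thesis
    unfolding entries_def by blast
qed

lemma eps_in_entries: "\<epsilon> \<in> entries m n A"
  using power_array.xi_in_entries[OF transpose] by (simp add: entries_swap[of n m A])

lemma power_entries: "x \<in> entries m n A \<Longrightarrow> x ^ k \<in> entries m n A"
  by (induction k) (auto intro: entries_mult one_in_entries)

section \<open>The natural orderings\<close>

lemma ordering_rows:
  assumes "x \<in> entries m n A"
  shows "ordering_perm (natural_rows m n A) x = \<xi> * x"
proof -
  obtain i j where x: "x = A i j" "i \<in> {1..m}" "j \<in> {1..n}"
    using assms by (auto simp: entries_def)
  have "\<xi> * \<xi> ^ (j - 1) = \<xi> ^ j"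
    using x(3) by (simp flip: power_Suc)
  \<comment> \<open>The wrap from column \<open>n\<close> to column 1 agrees with multiplication by
    \<xi> because \<open>\<xi> ^ n = 1\<close>.\<close>
  then have "A i (if j = n then 1 else j + 1) = \<xi> * A i j"
    using x(2,3) xi_power by (auto simp: array mult.left_commute)
  then show ?thesis
    using ordering_perm_natural_rows[OF inj_array x(2,3)] x(1) by simp
qed

lemma ordering_cols:
  assumes "x \<in> entries m n A"
  shows "ordering_perm (natural_cols m n A) x = \<epsilon> * x"
  using power_array.ordering_rows[OF transpose] assms by (simp add: natural_cols_swap entries_swap[of n m A])

lemma simple_rows: "l \<in> set (natural_rows m n A) \<Longrightarrow> simple_ordering l"
  using xi eps
  by (auto simp: natural_rows_def array simp del: upt_Suc
      intro!: simple_ordering_geometric[of "\<epsilon> ^ (_ - 1)" \<xi>])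

lemma simple_cols: "l \<in> set (natural_cols m n A) \<Longrightarrow> simple_ordering l"
  using power_array.simple_rows[OF transpose] by (simp add: natural_cols_swap)

lemma compatible_natural:
  "compatible (entries m n A) (ordering_perm (natural_rows m n A)) (ordering_perm (natural_cols m n A))"
proof -
  let ?f = "ordering_perm (natural_cols m n A) \<circ> ordering_perm (natural_rows m n A)"
  have iter: "(?f ^^ k) 1 = (\<epsilon> * \<xi>) ^ k" for k
  proof (induction k)
    case (Suc k)
    have "(\<epsilon> * \<xi>) ^ k \<in> entries m n A"
      by (auto simp: entries_eq_powers)
    then show ?case
      using Suc by (simp add: ordering_rows ordering_cols entries_mult xi_in_entries)
  qed simp
  \<comment> \<open>\<open>orbit\<close> collects positive iterates only, so a full period
    \<open>m * n\<close> is added to the exponent to include \<open>k = 0\<close>.\<close>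
  have "(\<epsilon> * \<xi>) ^ k \<in> orbit ?f 1" for k
    using iter[of "k + m * n"] pos unfolding orbit_altdef
    by (intro CollectI exI[of _ "k + m * n"]) (simp add: power_add generator_power)
  then have "orbit ?f 1 = entries m n A"
    by (auto simp: entries_eq_powers orbit_altdef iter)
  then show ?thesis
    using one_in_entries unfolding compatible_def cyclic_on_def by blast
qed

section \<open>Separating the entries from their negatives\<close>

lemma two_neq_zero: "(2::'a) \<noteq> 0"
proof
  assume "(2::'a) = 0"
  \<comment> \<open>The order of the field is odd, so it would map to 1; but the characteristic
    divides it, so it maps to 0.\<close>
  then have "of_nat (CARD('a)) = (1::'a)"
    by (simp add: card_field)
  moreover have "of_nat (CARD('a)) = (0::'a)"
    using CHAR_dvd_CARD[where 'a = 'a] by (simp only: of_nat_eq_0_iff_char_dvd)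
  ultimately show False
    by simp
qed

text \<open>Entries have \<open>m * n\<close>-th power 1. As \<open>m * n\<close> is odd, if both
  \<open>x\<close> and \<open>- x\<close> were entries then 1 would equal -1.\<close>

lemma uminus_notin_entries:
  assumes "x \<in> entries m n A"
  shows "- x \<notin> entries m n A"
proof
  have power_eq_1: "y ^ (m * n) = 1" if y: "y \<in> entries m n A" for y
  proof -
    obtain k where "y = (\<epsilon> * \<xi>) ^ k"
      using y by (auto simp: entries_eq_powers)
    then have "y ^ (m * n) = ((\<epsilon> * \<xi>) ^ (m * n)) ^ k"
      by (metis power_commuting_commutes power_mult mult.commute)
    then show ?thesis
      by (simp only: generator_power power_one)
  qed
  assume "- x \<in> entries m n A"
  then have "(- x) ^ (m * n) = 1" "x ^ (m * n) = 1"
    using assms power_eq_1 by auto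
  then have "(1::'a) + 1 = 0"
    using odd by (simp add: power_minus_odd eq_neg_iff_add_eq_0 neg_eq_iff_add_eq_0)
  then show False
    using two_neq_zero by simp
qed

lemma entries_nonzero: "0 \<notin> entries m n A"
  using xi eps by (auto simp: entries_eq_powers)

lemma entries_Un_uminus: "entries m n A \<union> uminus ` entries m n A = UNIV - {0}"
proof (rule card_seteq)
  have "card (entries m n A \<union> uminus ` entries m n A) = m * n + m * n"
    using uminus_notin_entries by (subst card_Un_disjoint) (auto simp: card_image card_entries)
  then show "card (UNIV - {0::'a}) \<le> card (entries m n A \<union> uminus ` entries m n A)"
    by (simp add: card_Diff_singleton card_field)
qed (use entries_nonzero in auto)

section \<open>The rotation as a single cycle\<close>

abbreviation rot0 :: "'a \<Rightarrow> 'a" where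
  "rot0 \<equiv> archdeacon_rot0 (entries m n A)
    (ordering_perm (natural_rows m n A)) (ordering_perm (natural_cols m n A))"

abbreviation rot :: "'a \<times> 'a \<Rightarrow> 'a \<times> 'a" where
  "rot \<equiv> archdeacon_rot (entries m n A)
    (ordering_perm (natural_rows m n A)) (ordering_perm (natural_cols m n A))"

lemma rot0_entries: "x \<in> entries m n A \<Longrightarrow> rot0 x = - (\<xi> * x)"
  by (simp add: archdeacon_rot0_def ordering_rows)

lemma rot0_uminus_entries: "x \<in> entries m n A \<Longrightarrow> rot0 (- x) = \<epsilon> * x"
  by (simp add: archdeacon_rot0_def ordering_cols uminus_notin_entries)

text \<open>Starting from 1, even iterates run through the powers of the generator, hence all
  entries; odd iterates are these times \<open>- \<xi>\<close>, hence all negatives of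
  entries.\<close>

lemma cyclic_rot0: "cyclic_on rot0 (UNIV - {0})"
proof -
  have even: "(rot0 ^^ (2 * k)) 1 = (\<epsilon> * \<xi>) ^ k" for k
  proof (induction k)
    case (Suc k)
    have "(\<epsilon> * \<xi>) ^ k \<in> entries m n A"
      by (auto simp: entries_eq_powers)
    then show ?case
      using Suc by (simp add: rot0_entries rot0_uminus_entries entries_mult xi_in_entries)
  qed simp
  have powers_in: "(\<epsilon> * \<xi>) ^ k \<in> entries m n A" for k
    by (auto simp: entries_eq_powers)
  have odd_iter: "(rot0 ^^ Suc (2 * k)) 1 = - (\<xi> * (\<epsilon> * \<xi>) ^ k)" for k
    using even[of k] rot0_entries[OF powers_in[of k]] by simp
  have "(\<epsilon> * \<xi>) ^ k \<in> orbit rot0 1" for k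
    using even[of "k + m * n"] pos unfolding orbit_altdef
    by (intro CollectI exI[of _ "2 * (k + m * n)"]) (simp add: power_add generator_power)
  then have sub: "entries m n A \<subseteq> orbit rot0 1"
    by (auto simp: entries_eq_powers)
  have sub_minus: "- x \<in> orbit rot0 1" if "x \<in> entries m n A" for x
  proof -
    \<comment> \<open>\<open>\<xi> ^ (n - 1)\<close> is the inverse of \<xi>, so this is the entry
      whose odd iterate is \<open>- x\<close>.\<close>
    have "\<xi> ^ (n - 1) * x \<in> entries m n A"
      using that by (intro entries_mult power_entries xi_in_entries)
    then obtain k where k: "\<xi> ^ (n - 1) * x = (\<epsilon> * \<xi>) ^ k"
      by (auto simp: entries_eq_powers)
    have "\<xi> * \<xi> ^ (n - 1) = 1"
      using pos xi_power by (simp flip: power_Suc)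
    then have "x = \<xi> * (\<xi> ^ (n - 1) * x)"
      by (metis mult.assoc mult_1)
    also have "\<dots> = \<xi> * (\<epsilon> * \<xi>) ^ k"
      by (simp only: k)
    finally have "- x = (rot0 ^^ Suc (2 * k)) 1"
      by (simp only: odd_iter)
    then show ?thesis
      unfolding orbit_altdef by blast
  qed
  have "(rot0 ^^ k) 1 \<noteq> 0" for k
  proof (cases "even k")
    case True
    then show ?thesis
      using xi(1) eps(1) by (auto elim!: evenE simp: even)
  next
    case False
    then obtain l where "k = Suc (2 * l)"
      by (auto elim: oddE)
    then show ?thesis
      using xi(1) eps(1) odd_iter[of l] by simp
  qed
  then have "orbit rot0 1 \<subseteq> UNIV - {0}"
    by (auto simp: orbit_altdef)
  then have "UNIV - {0} = orbit rot0 1"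
    using sub sub_minus entries_Un_uminus by blast
  then show ?thesis
    unfolding cyclic_on_def by (rule bexI[where x = 1]) simp
qed

section \<open>Faces\<close>

text \<open>The assumption \<open>step\<close> isolates what row and column faces share. Order above
  1 makes the full geometric sum vanish, which closes the walk.\<close>

lemma boundary_walk_geometric:
  assumes c: "c \<noteq> 0" "1 < mult_order c" and d: "d \<noteq> 0"
    and step: "\<And>k. rot0 (- (d * c ^ k)) = d * c ^ Suc k"
  shows "boundary_walk rot (x, x + d) = map (\<lambda>k. x + d * (\<Sum>i<k. c ^ i)) [0..<mult_order c]"
    and "distinct (boundary_walk rot (x, x + d))"
proof -
  have iter: "(face_step rot ^^ k) (x, x + d)
      = (x + d * (\<Sum>i<k. c ^ i), x + d * (\<Sum>i<Suc k. c ^ i))" for k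
  proof (induction k)
    case (Suc k)
    let ?v = "\<lambda>k. x + d * (\<Sum>i<k. c ^ i)"
    \<comment> \<open>\<open>face_step\<close> rotates the reversed arc, hence the minus sign, which
      matches \<open>step\<close>.\<close>
    have "?v k - ?v (Suc k) = - (d * c ^ k)"
      by (simp add: distrib_left)
    then have "face_step rot (?v k, ?v (Suc k)) = (?v (Suc k), ?v (Suc k) + d * c ^ Suc k)"
      by (simp only: face_step_def archdeacon_rot_def prod.case snd_conv step)
    also have "?v (Suc k) + d * c ^ Suc k = ?v (Suc (Suc k))"
      by (simp add: distrib_left add.assoc)
    finally show ?case
      by (simp only: funpow.simps comp_apply Suc)
  qed simp
  have inj: "inj_on (\<lambda>k. x + d * (\<Sum>i<k. c ^ i)) {..<mult_order c}"
    using geometric_sum_neq[OF c(1)] d by (intro linorder_inj_onI) auto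
  \<comment> \<open>Both ends of the arc must return: the full sum is 0, and one further term
    contributes \<open>c ^ mult_order c = 1\<close>.\<close>
  have period: "(face_step rot ^^ mult_order c) (x, x + d) = (x, x + d)"
    using geometric_sum_mult_order[OF c(2,1)] mult_order_pos_power[OF c(1)] by (simp add: iter)
  show walk: "boundary_walk rot (x, x + d) = map (\<lambda>k. x + d * (\<Sum>i<k. c ^ i)) [0..<mult_order c]"
    using boundary_walk_eq[OF _ period] inj c by (simp add: iter)
  show "distinct (boundary_walk rot (x, x + d))"
    using inj by (simp add: walk distinct_map atLeast0LessThan)
qed

lemma boundary_walk_col:
  assumes "d \<in> entries m n A" "1 < m"
  shows "length (boundary_walk rot (x, x + d)) = m" "distinct (boundary_walk rot (x, x + d))"
proof -
  have step: "rot0 (- (d * \<epsilon> ^ k)) = d * \<epsilon> ^ Suc k" for k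
    using rot0_uminus_entries[of "d * \<epsilon> ^ k"] assms
    by (simp add: entries_mult power_entries eps_in_entries mult_ac)
  have "d \<noteq> 0"
    using assms entries_nonzero by auto
  then show "length (boundary_walk rot (x, x + d)) = m" "distinct (boundary_walk rot (x, x + d))"
    using boundary_walk_geometric[OF eps(1) _ _ step] assms eps by auto
qed

text \<open>Here the reversed differences \<open>- (d * \<xi> ^ k)\<close> are themselves entries,
  so \<open>rot0\<close> multiplies by \<xi> and changes the sign back.\<close>

lemma boundary_walk_row:
  assumes "- d \<in> entries m n A" "1 < n"
  shows "length (boundary_walk rot (x, x + d)) = n" "distinct (boundary_walk rot (x, x + d))"
proof -
  have step: "rot0 (- (d * \<xi> ^ k)) = d * \<xi> ^ Suc k" for k
    using rot0_entries[of "- d * \<xi> ^ k"] entries_mult[OF assms(1) power_entries[OF xi_in_entries, of k]]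
    by (simp add: mult_ac)
  have "d \<noteq> 0"
    using assms entries_nonzero by auto
  then show "length (boundary_walk rot (x, x + d)) = n" "distinct (boundary_walk rot (x, x + d))"
    using boundary_walk_geometric[OF xi(1) _ _ step] assms xi by auto
qed

lemma arc_cases:
  assumes "e \<in> complete_arcs"
  obtains x d where "e = (x, x + d)" "d \<in> entries m n A \<or> - d \<in> entries m n A"
proof -
  obtain x y where e: "e = (x, y)" "x \<noteq> y"
    using assms by (auto simp: complete_arcs_def)
  then have "y - x \<in> entries m n A \<union> uminus ` entries m n A"
    by (simp add: entries_Un_uminus)
  then have "y - x \<in> entries m n A \<or> - (y - x) \<in> entries m n A"
    by force
  then show thesis
    using e by (intro that[of x "y - x"]) auto
qed

lemma faces_simple:
  assumes "1 < m" "1 < n" "F \<in> faces complete_arcs rot"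
  shows "simple_cycle complete_arcs F"
proof -
  obtain e where e: "e \<in> complete_arcs" "F = boundary_walk rot e"
    using assms unfolding faces_def by blast
  \<comment> \<open>Odd numbers above 1 reach the minimal length demanded by
    \<open>simple_cycle\<close>.\<close>
  have "3 \<le> m" "3 \<le> n"
    using assms odd by presburger+
  then show ?thesis
    using e(1) assms boundary_walk_row boundary_walk_col unfolding e(2)
    by (elim arc_cases) (auto intro!: simple_cycle_complete_arcs)
qed

lemma length_faces:
  assumes "1 < m" "1 < n"
  shows "length ` faces complete_arcs rot = {m, n}"
proof (intro equalityI subsetI)
  fix l
  assume "l \<in> length ` faces complete_arcs rot"
  then obtain e where "e \<in> complete_arcs" "l = length (boundary_walk rot e)"
    unfolding faces_def by blast
  then show "l \<in> {m, n}"
    using assms boundary_walk_row boundary_walk_col by (elim arc_cases) auto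
next
  fix l
  assume l: "l \<in> {m, n}"
  \<comment> \<open>Witnesses for both lengths: the difference 1 is an entry and -1 the negative of
    one.\<close>
  have arcs: "(0, 0 + 1) \<in> (complete_arcs :: ('a \<times> 'a) set)" "(0, 0 + - 1) \<in> (complete_arcs :: ('a \<times> 'a) set)"
    by (auto simp: complete_arcs_def)
  have "length (boundary_walk rot (0, 0 + 1)) = m" "length (boundary_walk rot (0, 0 + - 1)) = n"
    using boundary_walk_col(1)[of 1 0] boundary_walk_row(1)[of "- 1" 0] one_in_entries assms by auto
  then show "l \<in> length ` faces complete_arcs rot"
    using l arcs unfolding faces_def by (metis empty_iff image_eqI insertE)
qed

section \<open>The Heffter property\<close>

lemma row_sum:
  assumes "1 < n" "i \<in> {1..m}"
  shows "(\<Sum>j\<in>{1..n}. A i j) = 0"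
proof -
  have "(\<Sum>j\<in>{1..n}. A i j) = (\<Sum>j\<in>{1..n}. \<epsilon> ^ (i - 1) * \<xi> ^ (j - 1))"
    using assms(2) by (intro sum.cong refl array)
  also have "\<dots> = \<epsilon> ^ (i - 1) * (\<Sum>j<n. \<xi> ^ j)"
    by (simp add: sum.atLeast1_atMost_eq sum_distrib_left)
  finally show ?thesis
    using geometric_sum_mult_order[of \<xi>] xi assms by simp
qed

lemma heffter:
  assumes "1 < m" "1 < n"
  shows "heffter_array m n A"
  unfolding heffter_array_def
proof (intro conjI ballI)
  show "CARD('a) = 2 * m * n + 1"
    by (rule card_field)
  show "(\<Sum>j\<in>{1..n}. A i j) = 0" if "i \<in> {1..m}" for i
    using assms that by (intro row_sum)
  show "(\<Sum>i\<in>{1..m}. A i j) = 0" if "j \<in> {1..n}" for j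
    using power_array.row_sum[OF transpose] assms that by simp
  have inj_minus: "inj_on (\<lambda>p. - case_prod A p) ({1..m} \<times> {1..n})"
    using comp_inj_on[OF inj_array, of uminus] by (simp add: comp_def case_prod_unfold)
  have "(\<Sum>i\<in>{1..m}. \<Sum>j\<in>{1..n}. {#A i j, - A i j#})
      = (\<Sum>p\<in>{1..m} \<times> {1..n}. {#case_prod A p#} + {#- case_prod A p#})"
    unfolding sum.cartesian_product by (rule sum.cong) auto
  also have "\<dots> = (\<Sum>p\<in>{1..m} \<times> {1..n}. {#case_prod A p#})
      + (\<Sum>p\<in>{1..m} \<times> {1..n}. {#- case_prod A p#})"
    by (rule sum.distrib)
  \<comment> \<open>Injectivity makes each value occur once, so sums of singletons become multisets
    of sets.\<close>
  also have "\<dots> = mset_set (entries m n A) + mset_set (uminus ` entries m n A)"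
    using sum.reindex[OF inj_array, of "\<lambda>x. {#x#}"] sum.reindex[OF inj_minus, of "\<lambda>x. {#x#}"]
    by (simp add: entries_image image_image)
  also have "\<dots> = mset_set (entries m n A \<union> uminus ` entries m n A)"
    using uminus_notin_entries by (intro mset_set_Union[symmetric]) auto
  finally show "(\<Sum>i\<in>{1..m}. \<Sum>j\<in>{1..n}. {#A i j, - A i j#}) = mset_set (UNIV - {0})"
    by (simp only: entries_Un_uminus)
qed

end

text \<open>For \<open>m = 1\<close> a column is a single nonzero entry, with nonzero sum, and faces
  of ratio \<open>\<epsilon> = 1\<close> follow arithmetic progressions instead of closing after
  \<open>m\<close> steps; similarly for \<open>n = 1\<close>. Hence the guard on the last
  claims.\<close>

theorem theorem3p3:
  fixes m n :: nat
    and \<xi> \<epsilon> :: "'a::{field,finite}"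
    and A :: "nat \<Rightarrow> nat \<Rightarrow> 'a"
    and \<omega>r \<omega>c :: "'a \<Rightarrow> 'a"
    and \<rho> :: "'a \<times> 'a \<Rightarrow> 'a \<times> 'a"
  assumes "CARD('a) = 2 * m * n + 1"
    and "odd m" and "odd n" and "coprime m n"
    and "\<xi> \<noteq> 0" and "mult_order \<xi> = n"
    and "\<epsilon> \<noteq> 0" and "mult_order \<epsilon> = m"
    and "\<And>i j. i \<in> {1..m} \<Longrightarrow> j \<in> {1..n} \<Longrightarrow> A i j = \<epsilon> ^ (i - 1) * \<xi> ^ (j - 1)"
    and "\<omega>r = ordering_perm (natural_rows m n A)"
    and "\<omega>c = ordering_perm (natural_cols m n A)"
    and "\<rho> = archdeacon_rot (entries m n A) \<omega>r \<omega>c"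
  shows "(\<forall>l\<in>set (natural_rows m n A) \<union> set (natural_cols m n A). simple_ordering l) \<and>
    compatible (entries m n A) \<omega>r \<omega>c \<and>
    combinatorial_embedding UNIV complete_arcs \<rho> \<and>
    (1 < m \<and> 1 < n \<longrightarrow>
      heffter_array m n A \<and>
      (\<forall>F\<in>faces complete_arcs \<rho>. simple_cycle complete_arcs F) \<and>
      length ` faces complete_arcs \<rho> = {m, n})"
proof -
  interpret power_array m n \<xi> \<epsilon> A
    by (rule power_array.intro) (fact assms)+
  show ?thesis
    unfolding assms(10-12)
    using simple_rows simple_cols compatible_natural heffter faces_simple length_faces
      combinatorial_embedding_archdeacon_rot[OF cyclic_rot0] by blast
qed

end
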